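(* Let $X$ be an infinite dimensional real Banach space. Then $K_a(X)>1$.
   Context: For a Banach space $X$, $B_X$ denotes its closed unit ball and $X^*$ its dual. For positive constants $c_1,c_2,d$, a subset $S$ of a normed space $X$ is called a $(c_1,c_2,d)$-b.s.a. (bounded and separated antipodal) subset of $X$ if (1) $\|x\|\le c_1$ for all $x\in S$, and (2) for every $x,y\in S$ with $x\ne y$ there exists $f\in X^*$ with $\|f\|\le c_2$ such that $d\le f(y)-f(x)$ and $f(x)\le f(z)\le f(y)$ for all $z\in S$. For an infinite dimensional Banach space $X$, $$K_a(X)=\sup\{d>0:\ \text{there exists an infinite } S\subseteq B_X \text{ which is a } (1,1,d)\text{-b.s.a. subset of } X\}.$$ *)

theory Defs
  imports "HOL-Analysis.Analysis" "HOL-Library.Extended_Real"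
begin

definition infinite_dimensional :: "'a::real_vector itself \<Rightarrow> bool" where
  "infinite_dimensional _ \<longleftrightarrow> \<not> (\<exists>B::'a set. finite B \<and> span B = UNIV)"

(* Bounded and separated antipodal subsets. The dual space is the type of bounded
   linear functionals, whose norm is the operator norm. *)
definition bsa :: "real \<Rightarrow> real \<Rightarrow> real \<Rightarrow> 'a::real_normed_vector set \<Rightarrow> bool" where
  "bsa c1 c2 d S \<longleftrightarrow>
     (\<forall>x\<in>S. norm x \<le> c1) \<and>
     (\<forall>x\<in>S. \<forall>y\<in>S. x \<noteq> y \<longrightarrow>
        (\<exists>f :: 'a \<Rightarrow>\<^sub>L real. norm f \<le> c2 \<and>
           d \<le> blinfun_apply f y - blinfun_apply f x \<and>
           (\<forall>z\<in>S. blinfun_apply f x \<le> blinfun_apply f z \<and>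
                   blinfun_apply f z \<le> blinfun_apply f y)))"

(* The supremum is taken in the extended reals, so that it is meaningful without first
   showing that the set is nonempty and bounded above. *)
definition K_a :: "'a::banach itself \<Rightarrow> ereal" where
  "K_a _ = (SUP d \<in> {d::real. d > 0 \<and>
      (\<exists>S::'a set. infinite S \<and> S \<subseteq> cball 0 1 \<and> bsa 1 1 d S)}. ereal d)"

end

theory Submission
  imports Defs
begin

text \<open>
  Fix an ultrafilter on the unit sphere along which every bounded functional is eventually zero;
  ``most \<open>u\<close>'' refers to it. Call \<open>v\<close> tame for \<open>r\<close> if \<open>\<parallel>v - u\<parallel> \<le> r\<close> for most \<open>u\<close>, and consider
  sums \<open>v = u\<^sub>1 + u\<^sub>2 + \<dots>\<close> whose terms are chosen one after the other among most \<open>u\<close>.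
  Let \<open>2 > r\<^sub>0 > r\<^sub>1 > \<dots> > 1\<close>.

  Suppose that for some \<open>k\<close> and most \<open>a\<close> such a sum, kept tame for \<open>r = r\<^sub>k\<^sub>+\<^sub>1\<close>, is
  eventually steered to a \<open>v\<close> such that \<open>a + v\<close> is not tame for \<open>r' = r\<^sub>k\<close>. Then the vectors
  \<open>y\<^sub>m = v\<^sub>m - a\<^sub>m\<close>, where \<open>v\<^sub>m\<close> is played until this has happened for \<open>a\<^sub>n\<close> for all \<open>n < m\<close>,
  have norm at most \<open>r\<close>, while \<open>y\<^sub>m - y\<^sub>n\<close> contains the terms of \<open>a\<^sub>n + v - a\<^sub>m\<close>, a vector of
  norm greater than \<open>r'\<close>. Taking weak* limits of norming functionals backwards along the play
  yields functionals that are small on everything else.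

  Otherwise, choose \<open>a\<^sub>0, a\<^sub>1, \<dots>\<close> one after the other such that for no \<open>k\<close> the play with
  \<open>a = a\<^sub>k\<close> and \<open>r\<^sub>k\<^sub>+\<^sub>1, r\<^sub>k\<close> ever succeeds. Then tameness of \<open>0\<close> for \<open>r\<^sub>n\<close> propagates: \<open>a\<^sub>k + \<dots> + a\<^sub>n\<^sub>-\<^sub>1\<close> is tame
  for \<open>r\<^sub>k\<close> for \<open>k = n, n - 1, \<dots>, 0\<close>. Hence \<open>a\<^sub>0 + \<dots> + a\<^sub>n\<^sub>-\<^sub>1 - a\<^sub>n\<close> has norm at most \<open>r\<^sub>0 < 2\<close>,
  and a functional norming \<open>a\<^sub>n\<close> separates these vectors antipodally by \<open>2\<close>.
\<close>

section \<open>The Hahn--Banach theorem\<close>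

definition sublinear :: "('a::real_vector \<Rightarrow> real) \<Rightarrow> bool" where
  "sublinear p \<longleftrightarrow> (\<forall>x y. p (x + y) \<le> p x + p y) \<and> (\<forall>c>0. \<forall>x. p (c *\<^sub>R x) = c * p x)"

lemma sublinear_add: "sublinear p \<Longrightarrow> p (x + y) \<le> p x + p y"
  and sublinear_scale: "sublinear p \<Longrightarrow> c > 0 \<Longrightarrow> p (c *\<^sub>R x) = c * p x"
  by (auto simp: sublinear_def)

lemma sublinear_zero: "sublinear p \<Longrightarrow> p 0 = 0"
  using sublinear_scale[of p 2 0] by simp

lemma sublinear_minus: "sublinear p \<Longrightarrow> - p (- x) \<le> p x"
  using sublinear_add[of p x "- x"] sublinear_zero[of p] by simp

lemma sublinear_norm: "sublinear (norm :: 'a::real_normed_vector \<Rightarrow> real)"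
  by (simp add: sublinear_def norm_triangle_ineq)

text \<open>The infimum of \<open>p (y + t *\<^sub>R x) - t * p x\<close> over t >= 0 pins linear
  functionals: any linear one below \<open>q\<close> must equal \<open>p x\<close> at
  \<open>x\<close>.\<close>

lemma sublinear_shift:
  fixes p :: "'a::real_vector \<Rightarrow> real"
  assumes p: "sublinear p"
  obtains q where "sublinear q" "q \<le> p" "q (- x) \<le> - p x"
proof -
  define S where "S y = (\<lambda>t. p (y + t *\<^sub>R x) - t * p x) ` {0..}" for y
  define q where "q y = Inf (S y)" for y
  have ptx: "p (t *\<^sub>R x) = t * p x" if "t \<ge> 0" for t
    using that sublinear_scale[OF p, of t x] sublinear_zero[OF p] by (cases "t = 0") auto
  have bdd: "bdd_below (S y)" for y
  proof (rule bdd_belowI)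
    fix s assume "s \<in> S y"
    then obtain t where t: "t \<ge> 0" "s = p (y + t *\<^sub>R x) - t * p x" by (auto simp: S_def)
    have "p (t *\<^sub>R x) \<le> p (y + t *\<^sub>R x) + p (- y)"
      using sublinear_add[OF p, of "y + t *\<^sub>R x" "- y"] by simp
    with t ptx show "- p (- y) \<le> s" by simp
  qed
  have le: "q y \<le> p (y + t *\<^sub>R x) - t * p x" if "t \<ge> 0" for y t
    unfolding q_def by (rule cInf_lower[OF _ bdd]) (use that in \<open>auto simp: S_def\<close>)
  have ge: "c \<le> q y" if "\<And>t. t \<ge> 0 \<Longrightarrow> c \<le> p (y + t *\<^sub>R x) - t * p x" for c y
    unfolding q_def by (rule cInf_greatest) (use that in \<open>auto simp: S_def\<close>)
  have q_add: "q (y + z) \<le> q y + q z" for y z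
  proof -
    have *: "q (y + z) - (p (y + t *\<^sub>R x) - t * p x) \<le> q z" if t: "t \<ge> 0" for t
    proof (rule ge)
      fix s :: real assume s: "s \<ge> 0"
      have "q (y + z) \<le> p (y + z + (t + s) *\<^sub>R x) - (t + s) * p x" using t s by (intro le) auto
      also have "p (y + z + (t + s) *\<^sub>R x) \<le> p (y + t *\<^sub>R x) + p (z + s *\<^sub>R x)"
        using sublinear_add[OF p, of "y + t *\<^sub>R x" "z + s *\<^sub>R x"] by (simp add: algebra_simps)
      finally show "q (y + z) - (p (y + t *\<^sub>R x) - t * p x) \<le> p (z + s *\<^sub>R x) - s * p x"
        by (simp add: algebra_simps)
    qed
    have "q (y + z) - q z \<le> q y" by (rule ge) (use * in \<open>force simp: algebra_simps\<close>)
    then show ?thesis by simp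
  qed
  have q_le: "q (c *\<^sub>R y) \<le> c * q y" if c: "c > 0" for c y
  proof -
    have "q (c *\<^sub>R y) / c \<le> q y"
    proof (rule ge)
      fix t :: real assume t: "t \<ge> 0"
      have "q (c *\<^sub>R y) \<le> p (c *\<^sub>R y + (c * t) *\<^sub>R x) - (c * t) * p x" using c t by (intro le) auto
      also have "p (c *\<^sub>R y + (c * t) *\<^sub>R x) = c * p (y + t *\<^sub>R x)"
        using sublinear_scale[OF p c, of "y + t *\<^sub>R x"] by (simp add: algebra_simps)
      finally show "q (c *\<^sub>R y) / c \<le> p (y + t *\<^sub>R x) - t * p x"
        using c by (simp add: field_simps)
    qed
    then show ?thesis using c by (simp add: field_simps)
  qed
  have q_scale: "q (c *\<^sub>R y) = c * q y" if c: "c > 0" for c y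
    using q_le[OF c, of y] q_le[of "inverse c" "c *\<^sub>R y"] c by (simp add: field_simps)
  show thesis
  proof
    show "sublinear q" using q_add q_scale by (auto simp: sublinear_def)
    show "q \<le> p" using le[of 0] by (auto simp: le_fun_def)
    show "q (- x) \<le> - p x" using le[of 1 "- x"] sublinear_zero[OF p] by simp
  qed
qed

text \<open>The pointwise infimum works: of two members of the chain the smaller one serves both
  arguments, which saves subadditivity. Comparison with \<open>p0\<close> keeps the infimum
  finite.\<close>

lemma sublinear_chain_lower_bound:
  fixes C :: "('a::real_vector \<Rightarrow> real) set"
  assumes "C \<noteq> {}" and sub: "\<And>p. p \<in> C \<Longrightarrow> sublinear p"
    and chain: "\<And>p q. p \<in> C \<Longrightarrow> q \<in> C \<Longrightarrow> p \<le> q \<or> q \<le> p"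
  obtains u where "sublinear u" "\<And>p. p \<in> C \<Longrightarrow> u \<le> p"
proof -
  obtain p0 where p0: "p0 \<in> C" using \<open>C \<noteq> {}\<close> by auto
  define u where "u x = (INF p\<in>C. p x)" for x
  have bdd: "bdd_below ((\<lambda>p. p x) ` C)" for x
  proof (rule bdd_belowI2[where m = "- p0 (- x)"])
    fix p assume p: "p \<in> C"
    from chain[OF p p0] show "- p0 (- x) \<le> p x"
    proof
      assume "p \<le> p0"
      from le_funD[OF this, of "- x"] sublinear_minus[OF sub[OF p], of x] show ?thesis by simp
    next
      assume "p0 \<le> p"
      from le_funD[OF this, of x] sublinear_minus[OF sub[OF p0], of x] show ?thesis by simp
    qed
  qed
  have le: "u x \<le> p x" if "p \<in> C" for p x
    unfolding u_def using bdd that by (rule cINF_lower)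
  have ge: "c \<le> u x" if "\<And>p. p \<in> C \<Longrightarrow> c \<le> p x" for c x
    unfolding u_def using \<open>C \<noteq> {}\<close> that by (rule cINF_greatest)
  have u_add: "u (x + y) \<le> u x + u y" for x y
  proof -
    have *: "u (x + y) - p x \<le> u y" if p: "p \<in> C" for p
    proof (rule ge)
      fix q assume q: "q \<in> C"
      from chain[OF p q] show "u (x + y) - p x \<le> q y"
      proof
        assume "p \<le> q"
        from le_funD[OF this, of y] le[OF p, of "x + y"] sublinear_add[OF sub[OF p], of x y]
        show ?thesis by simp
      next
        assume "q \<le> p"
        from le_funD[OF this, of x] le[OF q, of "x + y"] sublinear_add[OF sub[OF q], of x y]
        show ?thesis by simp
      qed
    qed
    have "u (x + y) - u y \<le> u x" by (rule ge) (use * in \<open>force simp: algebra_simps\<close>)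
    then show ?thesis by simp
  qed
  have u_le: "u (c *\<^sub>R x) \<le> c * u x" if c: "c > 0" for c x
  proof -
    have "u (c *\<^sub>R x) / c \<le> u x"
      by (rule ge) (use le[of _ "c *\<^sub>R x"] sublinear_scale[OF sub c] c in \<open>force simp: field_simps\<close>)
    then show ?thesis using c by (simp add: field_simps)
  qed
  have "u (c *\<^sub>R x) = c * u x" if c: "c > 0" for c x
    using u_le[OF c, of x] u_le[of "inverse c" "c *\<^sub>R x"] c by (simp add: field_simps)
  then have "sublinear u" using u_add by (auto simp: sublinear_def)
  with le that show thesis by (auto simp: le_fun_def)
qed

text \<open>By minimality the shift at \<open>x\<close> leaves \<open>m\<close> unchanged, so
  \<open>m\<close> is odd; odd and subadditive imply additive.\<close>

lemma minimal_sublinear_is_linear: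
  fixes m :: "'a::real_vector \<Rightarrow> real"
  assumes m: "sublinear m" and min: "\<And>q. sublinear q \<Longrightarrow> q \<le> m \<Longrightarrow> q = m"
  shows "linear m"
proof -
  have odd: "m (- x) = - m x" for x
  proof -
    obtain q where "sublinear q" "q \<le> m" "q (- x) \<le> - m x" using sublinear_shift[OF m] .
    with min sublinear_minus[OF m, of x] show ?thesis by force
  qed
  have "m (x + y) = m x + m y" for x y
    using sublinear_add[OF m, of x y] sublinear_add[OF m, of "- x" "- y"] odd[of x] odd[of y]
      odd[of "x + y"] by (simp add: algebra_simps)
  moreover have "m (c *\<^sub>R x) = c * m x" for c x
  proof (cases c "0 :: real" rule: linorder_cases)
    case less
    then show ?thesis using sublinear_scale[OF m, of "- c" x] odd[of "c *\<^sub>R x"] by simp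
  qed (use sublinear_scale[OF m] sublinear_zero[OF m] in auto)
  ultimately show ?thesis by (intro linearI) auto
qed

lemma linear_below_sublinear:
  fixes p :: "'a::real_vector \<Rightarrow> real"
  assumes p: "sublinear p"
  obtains f where "linear f" "f \<le> p"
proof -
  let ?A = "{q. sublinear q \<and> q \<le> p}"
  have "\<exists>m\<in>?A. \<forall>q\<in>?A. q \<le> m \<longrightarrow> q = m"
  \<comment> \<open>Zorn's lemma is applied to the reversed pointwise order, to get a minimal
    element.\<close>
  proof (rule predicate_Zorn)
    show "partial_order_on ?A (relation_of (\<lambda>a b. b \<le> a) ?A)"
      by (rule partial_order_on_relation_ofI) auto
    fix C assume C: "C \<in> Chains (relation_of (\<lambda>a b. b \<le> a) ?A)"
    then have CA: "C \<subseteq> ?A" by (auto simp: Chains_def relation_of_def)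
    show "\<exists>u\<in>?A. \<forall>a\<in>C. u \<le> a"
    proof (cases "C = {}")
      case True
      with p show ?thesis by auto
    next
      case False
      then obtain u where u: "sublinear u" "\<And>q. q \<in> C \<Longrightarrow> u \<le> q"
        by (rule sublinear_chain_lower_bound) (use C in \<open>auto simp: Chains_def relation_of_def\<close>)
      obtain q where "q \<in> C" using False by auto
      with u(2) CA have "u \<le> p" by (auto intro: order_trans[of u q p])
      with u show ?thesis by auto
    qed
  qed
  then obtain m where m: "sublinear m" "m \<le> p" and *: "\<forall>q\<in>?A. q \<le> m \<longrightarrow> q = m" by auto
  have "q = m" if "sublinear q" "q \<le> m" for q
    using * that order_trans[OF that(2) m(2)] by simp
  then have "linear m" by (rule minimal_sublinear_is_linear[OF m(1)])
  then show thesis using m(2) by (rule that)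
qed

lemma norming_functional:
  fixes x :: "'a::real_normed_vector"
  obtains f :: "'a \<Rightarrow>\<^sub>L real" where "norm f \<le> 1" "blinfun_apply f x = norm x"
proof -
  \<comment> \<open>The shift forces a linear functional below the norm to attain it at \<open>x\<close>.\<close>
  obtain q where q: "sublinear q" "q \<le> norm" "q (- x) \<le> - norm x"
    using sublinear_shift[OF sublinear_norm] .
  obtain g where g: "linear g" "g \<le> q" using linear_below_sublinear[OF q(1)] .
  have le: "g y \<le> norm y" for y using le_funD[OF g(2), of y] le_funD[OF q(2), of y] by simp
  have abs: "norm (g y) \<le> norm y * 1" for y
    using le[of y] le[of "- y"] linear_neg[OF g(1), of y] by (simp add: abs_le_iff)
  have bl: "bounded_linear g"
  proof (rule bounded_linear_intro)
    show "g (x + y) = g x + g y" for x y by (rule linear_add[OF g(1)])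
    show "g (c *\<^sub>R x) = c *\<^sub>R g x" for c x by (rule linear_scale[OF g(1)])
  qed (rule abs)
  show thesis
  proof
    show "norm (Blinfun g) \<le> 1"
      by (rule norm_blinfun_bound) (use abs in \<open>auto simp: bounded_linear_Blinfun_apply[OF bl]\<close>)
    have "g (- x) \<le> - norm x" using le_funD[OF g(2), of "- x"] q(3) by simp
    then have "g x = norm x" using le[of x] linear_neg[OF g(1), of x] by simp
    then show "blinfun_apply (Blinfun g) x = norm x"
      by (simp add: bounded_linear_Blinfun_apply[OF bl])
  qed
qed

section \<open>Weakly null ultrafilters on the unit sphere\<close>

definition ultra :: "'a filter \<Rightarrow> bool" where
  "ultra U \<longleftrightarrow> U \<noteq> bot \<and> (\<forall>P. eventually P U \<or> (\<forall>\<^sub>F x in U. \<not> P x))"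

text \<open>A minimal proper filter below \<open>F\<close> is ultra: unless \<open>P\<close> fails
  eventually, restricting to \<open>P\<close> keeps the filter proper and so changes
  nothing.\<close>

lemma ultra_extension:
  fixes F :: "'a filter"
  assumes F: "F \<noteq> bot"
  obtains U where "U \<le> F" "ultra U"
proof -
  let ?A = "{G. G \<noteq> bot \<and> G \<le> F}"
  have "\<exists>m\<in>?A. \<forall>G\<in>?A. G \<le> m \<longrightarrow> G = m"
  proof (rule predicate_Zorn)
    show "partial_order_on ?A (relation_of (\<lambda>a b. b \<le> a) ?A)"
      by (rule partial_order_on_relation_ofI) auto
    fix C assume C: "C \<in> Chains (relation_of (\<lambda>a b. b \<le> a) ?A)"
    then have CA: "C \<subseteq> ?A" by (auto simp: Chains_def relation_of_def)
    show "\<exists>u\<in>?A. \<forall>a\<in>C. u \<le> a"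
    proof (cases "C = {}")
      case True
      with F show ?thesis by auto
    next
      case False
      have "Inf C = bot \<longleftrightarrow> (\<exists>G\<in>C. G = bot)"
        unfolding trivial_limit_def using False C
        by (intro eventually_Inf_base) (auto simp: Chains_def relation_of_def)
      with CA have "Inf C \<noteq> bot" by auto
      moreover obtain G where "G \<in> C" using False by auto
      then have "Inf C \<le> F" using CA by (auto intro: Inf_lower2[of G])
      ultimately have "Inf C \<in> ?A" by simp
      then show ?thesis by (rule bexI[rotated]) (simp add: Inf_lower)
    qed
  qed
  then obtain U where U: "U \<noteq> bot" "U \<le> F" and *: "\<forall>G\<in>?A. G \<le> U \<longrightarrow> G = U" by auto
  have min: "G = U" if "G \<noteq> bot" "G \<le> U" for G
    using * that order_trans[OF that(2) U(2)] by simp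
  have "eventually P U" if P: "\<not> (\<forall>\<^sub>F x in U. \<not> P x)" for P
  proof -
    have "inf U (principal {x. P x}) \<noteq> bot"
      using P by (simp add: trivial_limit_def eventually_inf_principal)
    then have eq: "inf U (principal {x. P x}) = U" by (rule min) simp
    have "eventually P (inf U (principal {x. P x}))" by (simp add: eventually_inf_principal)
    with eq show ?thesis by simp
  qed
  with U(1) have "ultra U" by (auto simp: ultra_def)
  with U(2) show thesis by (rule that)
qed

text \<open>Compactness gives a cluster point of the image filter; an ultrafilter decides every
  neighbourhood, so the cluster point is a limit.\<close>

lemma ultra_convergent:
  fixes f :: "'b \<Rightarrow> 'c::topological_space"
  assumes U: "ultra U" and S: "compact S" and ev: "\<forall>\<^sub>F x in U. f x \<in> S"
  obtains l where "l \<in> S" "(f \<longlongrightarrow> l) U"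
proof -
  have "filtermap f U \<noteq> bot" using U by (simp add: ultra_def filtermap_bot_iff)
  with S ev obtain l where l: "l \<in> S" "inf (nhds l) (filtermap f U) \<noteq> bot"
    unfolding compact_filter by (auto simp: eventually_filtermap)
  have "(f \<longlongrightarrow> l) U"
  proof (rule topological_tendstoI, rule ccontr)
    fix T assume T: "open T" "l \<in> T" and "\<not> (\<forall>\<^sub>F x in U. f x \<in> T)"
    then have "\<forall>\<^sub>F x in U. f x \<notin> T" using U by (auto simp: ultra_def)
    moreover have "\<forall>\<^sub>F y in nhds l. y \<in> T" using T by (rule eventually_nhds_in_open)
    ultimately have "\<forall>\<^sub>F y in inf (nhds l) (filtermap f U). False"
      unfolding eventually_inf eventually_filtermap by (intro exI conjI) auto
    with l show False by simp
  qed
  with l that show thesis by blast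
qed

text \<open>Banach-Alaoglu along an ultrafilter: the values converge pointwise in compact intervals,
  and uniqueness of limits gives linearity.\<close>

lemma ultra_weak_star_limit:
  fixes F :: "'b \<Rightarrow> ('a::real_normed_vector \<Rightarrow>\<^sub>L real)"
  assumes U: "ultra U" and ev: "\<forall>\<^sub>F u in U. norm (F u) \<le> 1"
  obtains g where "norm g \<le> 1" "\<And>x. ((\<lambda>u. blinfun_apply (F u) x) \<longlongrightarrow> blinfun_apply g x) U"
proof -
  have nbot: "U \<noteq> bot" using U by (simp add: ultra_def)
  have bnd: "\<bar>blinfun_apply h x\<bar> \<le> norm x" if "norm h \<le> 1" for h :: "'a \<Rightarrow>\<^sub>L real" and x
    using norm_blinfun[of h x] mult_right_mono[OF that, of "norm x"] by simp
  have "\<exists>l\<in>{- norm x..norm x}. ((\<lambda>u. blinfun_apply (F u) x) \<longlongrightarrow> l) U" for x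
  proof -
    have "\<forall>\<^sub>F u in U. blinfun_apply (F u) x \<in> {- norm x..norm x}"
    proof (use ev in eventually_elim)
      case (elim u)
      from bnd[OF elim, of x] show ?case by auto
    qed
    from ultra_convergent[OF U compact_Icc this] show ?thesis by blast
  qed
  then obtain l where l: "\<And>x. l x \<in> {- norm x..norm x}"
      and lim: "\<And>x. ((\<lambda>u. blinfun_apply (F u) x) \<longlongrightarrow> l x) U" by metis
  have "l (x + y) = l x + l y" for x y
    using tendsto_add[OF lim[of x] lim[of y]] lim[of "x + y"] tendsto_unique[OF nbot]
    by (simp add: blinfun.add_right)
  moreover have "l (c *\<^sub>R x) = c *\<^sub>R l x" for c x
    using tendsto_mult_left[OF lim[of x], of c] lim[of "c *\<^sub>R x"] tendsto_unique[OF nbot]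
    by (simp add: blinfun.scaleR_right)
  moreover have abs: "norm (l x) \<le> norm x * 1" for x using l[of x] by auto
  ultimately have bl: "bounded_linear l" by (rule bounded_linear_intro)
  show thesis
  proof
    show "norm (Blinfun l) \<le> 1"
      by (rule norm_blinfun_bound) (use abs in \<open>auto simp: bounded_linear_Blinfun_apply[OF bl]\<close>)
  qed (simp add: bounded_linear_Blinfun_apply[OF bl] lim)
qed

text \<open>Each further functional lowers the dimension of the common kernel by at most
  one.\<close>

lemma finite_codimension_kernel_nontrivial:
  fixes A :: "('a::real_normed_vector \<Rightarrow>\<^sub>L real) set"
  assumes inf: "infinite_dimensional TYPE('a)" and "finite A"
  obtains x where "norm x = 1" "\<And>f. f \<in> A \<Longrightarrow> blinfun_apply f x = 0"
proof -
  have *: "\<not> (\<exists>B. finite B \<and> {x. \<forall>f\<in>A. blinfun_apply f x = 0} \<subseteq> span B)"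
    using \<open>finite A\<close>
  proof induction
    case empty
    with inf show ?case by (auto simp: infinite_dimensional_def)
  next
    case (insert f A)
    show ?case
    proof
      assume "\<exists>B. finite B \<and> {x. \<forall>f\<in>insert f A. blinfun_apply f x = 0} \<subseteq> span B"
      then obtain B where B: "finite B" "{x. \<forall>f\<in>insert f A. blinfun_apply f x = 0} \<subseteq> span B" by auto
      have "\<exists>C. finite C \<and> {x. \<forall>f\<in>A. blinfun_apply f x = 0} \<subseteq> span C"
      proof (cases "\<exists>b. (\<forall>g\<in>A. blinfun_apply g b = 0) \<and> blinfun_apply f b \<noteq> 0")
        case True
        then obtain b where b: "\<And>g. g \<in> A \<Longrightarrow> blinfun_apply g b = 0" "blinfun_apply f b \<noteq> 0" by auto
        have "x \<in> span (insert b B)" if x: "\<forall>g\<in>A. blinfun_apply g x = 0" for x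
        proof -
          have "x - (blinfun_apply f x / blinfun_apply f b) *\<^sub>R b \<in> span B"
            using B(2) b x by (intro subsetD[OF B(2)]) (auto simp: blinfun.diff_right blinfun.scaleR_right)
          then show ?thesis unfolding span_insert by blast
        qed
        with B(1) show ?thesis by (intro exI[of _ "insert b B"]) auto
      next
        case False
        with B show ?thesis by (intro exI[of _ B]) auto
      qed
      with insert.IH show False by blast
    qed
  qed
  have "\<not> {x. \<forall>f\<in>A. blinfun_apply f x = 0} \<subseteq> span {}" using * by blast
  then obtain x where x: "x \<noteq> 0" "\<And>f. f \<in> A \<Longrightarrow> blinfun_apply f x = 0" by auto
  show thesis
    by (rule that[of "x /\<^sub>R norm x"]) (use x in \<open>auto simp: blinfun.scaleR_right\<close>)
qed

locale weakly_null_ultrafilter =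
  fixes U :: "'a::real_normed_vector filter"
  assumes ultra: "ultra U"
    and sphere: "\<forall>\<^sub>F u in U. norm u = 1"
    and weakly_null: "\<And>f :: 'a \<Rightarrow>\<^sub>L real. \<forall>\<^sub>F u in U. blinfun_apply f u = 0"

text \<open>The unit spheres of the kernels have the finite intersection property, so they generate
  a proper filter.\<close>

lemma weakly_null_ultrafilter_exists:
  assumes inf: "infinite_dimensional TYPE('a::real_normed_vector)"
  obtains U :: "'a::real_normed_vector filter" where "weakly_null_ultrafilter U"
proof -
  define K where "K f = {x::'a. norm x = 1 \<and> blinfun_apply f x = (0::real)}" for f
  have "(INF f. principal (K f)) \<noteq> bot"
  proof (rule INF_filter_not_bot)
    fix A :: "('a \<Rightarrow>\<^sub>L real) set" assume "finite A"
    then obtain x where "norm x = 1" "\<And>f. f \<in> A \<Longrightarrow> blinfun_apply f x = 0"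
      using finite_codimension_kernel_nontrivial[OF inf] by blast
    then have "x \<in> (\<Inter>f\<in>A. K f)" by (auto simp: K_def)
    then show "(INF f\<in>A. principal (K f)) \<noteq> bot"
      using \<open>finite A\<close> by (auto simp: INF_principal_finite principal_eq_bot_iff)
  qed
  then obtain U where U: "U \<le> (INF f. principal (K f))" "ultra U" by (rule ultra_extension)
  have ev: "\<forall>\<^sub>F u in U. u \<in> K f" for f
    by (rule filter_leD[OF U(1)], rule eventually_INF1[of f]) (auto simp: eventually_principal)
  have "weakly_null_ultrafilter U"
  proof
    show "\<forall>\<^sub>F u in U. norm u = 1" using ev[of 0] by eventually_elim (simp add: K_def)
    show "\<forall>\<^sub>F u in U. blinfun_apply f u = 0" for f :: "'a \<Rightarrow>\<^sub>L real" using ev[of f] by eventually_elim (simp add: K_def)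
  qed (fact U)
  then show thesis by (rule that)
qed

section \<open>Steering sums of weakly null vectors\<close>

text \<open>Only pairs n < m are listed, as -f serves the swapped pair. After rescaling to the unit
  ball what counts is \<open>d / R\<close>.\<close>

definition antipodal_sequence :: "real \<Rightarrow> real \<Rightarrow> (nat \<Rightarrow> 'a::real_normed_vector) \<Rightarrow> bool" where
  "antipodal_sequence R d y \<longleftrightarrow> (\<forall>n. norm (y n) \<le> R) \<and>
     (\<forall>n m. n < m \<longrightarrow> (\<exists>f :: 'a \<Rightarrow>\<^sub>L real. norm f \<le> 1 \<and> d \<le> blinfun_apply f (y m) - blinfun_apply f (y n) \<and>
       (\<forall>k. blinfun_apply f (y n) \<le> blinfun_apply f (y k) \<and> blinfun_apply f (y k) \<le> blinfun_apply f (y m))))"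

lemma K_a_gt_one_if_antipodal_sequence:
  fixes y :: "nat \<Rightarrow> 'a::banach"
  assumes R: "0 < R" "R < d" and y: "antipodal_sequence R d y"
  shows "K_a TYPE('a) > 1"
proof -
  define z where "z n = y n /\<^sub>R R" for n
  define S where "S = range z"
  have sepz: "\<exists>f :: 'a \<Rightarrow>\<^sub>L real. norm f \<le> 1 \<and> d / R \<le> blinfun_apply f (z m) - blinfun_apply f (z n) \<and>
                (\<forall>k. blinfun_apply f (z n) \<le> blinfun_apply f (z k) \<and> blinfun_apply f (z k) \<le> blinfun_apply f (z m))" if ne: "n \<noteq> m" for n m
  proof -
    have "\<exists>f :: 'a \<Rightarrow>\<^sub>L real. norm f \<le> 1 \<and> d \<le> blinfun_apply f (y m) - blinfun_apply f (y n) \<and>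
                (\<forall>k. blinfun_apply f (y n) \<le> blinfun_apply f (y k) \<and> blinfun_apply f (y k) \<le> blinfun_apply f (y m))"
    proof (cases "n < m")
      case True
      then show ?thesis using y by (simp add: antipodal_sequence_def)
    next
      case False
      with ne y obtain f :: "'a \<Rightarrow>\<^sub>L real" where "norm f \<le> 1" "d \<le> blinfun_apply f (y n) - blinfun_apply f (y m)"
        "\<And>k. blinfun_apply f (y m) \<le> blinfun_apply f (y k) \<and> blinfun_apply f (y k) \<le> blinfun_apply f (y n)"
        unfolding antipodal_sequence_def by (metis linorder_neqE_nat)
      then show ?thesis by (intro exI[of _ "- f"]) (auto simp: blinfun.minus_left)
    qed
    then obtain f :: "'a \<Rightarrow>\<^sub>L real" where f: "norm f \<le> 1" "d \<le> blinfun_apply f (y m) - blinfun_apply f (y n)"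
      "\<And>k. blinfun_apply f (y n) \<le> blinfun_apply f (y k)" "\<And>k. blinfun_apply f (y k) \<le> blinfun_apply f (y m)" by auto
    then show ?thesis
      using R(1) by (intro exI[of _ f]) (auto simp: z_def blinfun.scaleR_right field_simps)
  qed
  have dR: "d / R > 1" using R by simp
  have "inj z"
  proof (rule injI, rule ccontr)
    fix n m assume "z n = z m" "n \<noteq> m"
    with sepz[of n m] dR show False by auto
  qed
  have norm_z: "norm (z n) \<le> 1" for n using R(1) y by (simp add: z_def antipodal_sequence_def field_simps)
  have "infinite S" unfolding S_def using \<open>inj z\<close> by (rule range_inj_infinite)
  moreover have "bsa 1 1 (d / R) S"
    unfolding bsa_def S_def
  proof (intro conjI ballI impI)
    fix x y assume "x \<in> range z" "y \<in> range z" "x \<noteq> y"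
    then obtain n m where "x = z n" "y = z m" "n \<noteq> m" by auto
    with sepz[of n m] show "\<exists>f :: 'a \<Rightarrow>\<^sub>L real. norm f \<le> 1 \<and> d / R \<le> blinfun_apply f y - blinfun_apply f x \<and>
        (\<forall>w\<in>range z. blinfun_apply f x \<le> blinfun_apply f w \<and> blinfun_apply f w \<le> blinfun_apply f y)"
      by auto
  qed (use norm_z in auto)
  moreover have "S \<subseteq> cball 0 1" using norm_z by (auto simp: S_def)
  ultimately have "d / R \<in> {d. d > 0 \<and> (\<exists>S::'a set. infinite S \<and> S \<subseteq> cball 0 1 \<and> bsa 1 1 d S)}"
    using dR by (intro CollectI conjI exI[of _ S]) auto
  then have "ereal (d / R) \<le> K_a TYPE('a)"
    unfolding K_a_def by (rule SUP_upper)
  moreover have "1 < ereal (d / R)" using dR by simp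
  ultimately show ?thesis by (rule less_le_trans[rotated])
qed

definition norming :: "'a::real_normed_vector \<Rightarrow> ('a \<Rightarrow>\<^sub>L real)" where
  "norming x = (SOME f. norm f \<le> 1 \<and> blinfun_apply f x = norm x)"

lemma norming: "norm (norming x) \<le> 1" "blinfun_apply (norming x) x = norm x"
proof -
  have "\<exists>f. norm f \<le> 1 \<and> blinfun_apply f x = norm x" using norming_functional by metis
  from someI_ex[OF this] show "norm (norming x) \<le> 1" "blinfun_apply (norming x) x = norm x"
    by (auto simp: norming_def)
qed

text \<open>Permits the recursive occurrence under \<open>eventually\<close> in the inductive
  predicate \<open>steers\<close>.\<close>

lemma eventually_mono_rule [mono]:
  "(\<And>x. P x \<longrightarrow> Q x) \<Longrightarrow> eventually P F \<longrightarrow> eventually Q F"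
  by (auto elim: eventually_mono)

context weakly_null_ultrafilter
begin

lemma nontrivial: "U \<noteq> bot"
  using ultra by (simp add: ultra_def)

lemma not_eventually_iff: "\<not> eventually P U \<longleftrightarrow> (\<forall>\<^sub>F u in U. \<not> P u)"
  using ultra by (auto simp: ultra_def dest: eventually_elim2[where R = "\<lambda>_. False"])

lemma weak_star_limit:
  assumes "\<forall>\<^sub>F u in U. norm (F u) \<le> 1"
  obtains g :: "'a \<Rightarrow>\<^sub>L real" where "norm g \<le> 1" "\<And>x. ((\<lambda>u. blinfun_apply (F u) x) \<longlongrightarrow> blinfun_apply g x) U"
  using ultra_weak_star_limit[OF ultra assms] by blast

definition tame :: "real \<Rightarrow> 'a \<Rightarrow> bool" where
  "tame r v \<longleftrightarrow> (\<forall>\<^sub>F u in U. norm (v - u) \<le> r)"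

lemma tame_zero: "1 \<le> r \<Longrightarrow> tame r 0"
  using sphere by (auto simp: tame_def elim: eventually_mono)

text \<open>
  The functional \<open>g\<close> is the iterated weak* limit, along all plays that start at \<open>v\<close>, of functionals
  witnessing \<open>\<parallel>a + w - u\<parallel> > r'\<close> at the final position \<open>w\<close>. Being a limit, it can be approximated on
  any finite set after every move.
\<close>

inductive steers :: "real \<Rightarrow> real \<Rightarrow> 'a \<Rightarrow> 'a \<Rightarrow> ('a \<Rightarrow>\<^sub>L real) \<Rightarrow> bool" for r r' a where
  stop: "\<lbrakk>tame r v; \<forall>\<^sub>F u in U. norm (F u) \<le> 1 \<and> r' < blinfun_apply (F u) (a + v - u);
          norm g \<le> 1; \<And>x. ((\<lambda>u. blinfun_apply (F u) x) \<longlongrightarrow> blinfun_apply g x) U\<rbrakk>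
         \<Longrightarrow> steers r r' a v g"
| move: "\<lbrakk>tame r v; \<forall>\<^sub>F u in U. steers r r' a (v + u) (F u);
          norm g \<le> 1; \<And>x. ((\<lambda>u. blinfun_apply (F u) x) \<longlongrightarrow> blinfun_apply g x) U\<rbrakk>
         \<Longrightarrow> steers r r' a v g"

lemma steers_norm: "steers r r' a v g \<Longrightarrow> norm g \<le> 1"
  by (auto elim: steers.cases)

text \<open>Weak-star compactness always supplies the limit functional, so an unsteerable tame
  position must violate the remaining premise of both rules of \<open>steers\<close>.\<close>

lemma not_steers:
  assumes v: "tame r v" and no: "\<not> (\<exists>g. steers r r' a v g)"
  shows "tame r' (a + v)" and "\<forall>\<^sub>F u in U. \<not> (\<exists>g. steers r r' a (v + u) g)"
proof -
  show "tame r' (a + v)"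
  proof (rule ccontr)
    assume "\<not> tame r' (a + v)"
    then have *: "\<forall>\<^sub>F u in U. norm (norming (a + v - u)) \<le> 1 \<and>
        r' < blinfun_apply (norming (a + v - u)) (a + v - u)"
      by (simp add: tame_def not_eventually_iff norming not_le)
    then have "\<forall>\<^sub>F u in U. norm (norming (a + v - u)) \<le> 1" by (simp add: norming)
    from weak_star_limit[OF this] obtain g where "norm g \<le> 1"
      "\<And>x. ((\<lambda>u. blinfun_apply (norming (a + v - u)) x) \<longlongrightarrow> blinfun_apply g x) U" by blast
    with steers.stop[OF v *] no show False by blast
  qed
  show "\<forall>\<^sub>F u in U. \<not> (\<exists>g. steers r r' a (v + u) g)"
  proof (rule ccontr)
    define F where "F u = (SOME g. steers r r' a (v + u) g)" for u
    assume "\<not> (\<forall>\<^sub>F u in U. \<not> (\<exists>g. steers r r' a (v + u) g))"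
    then have "\<forall>\<^sub>F u in U. \<exists>g. steers r r' a (v + u) g" by (simp add: not_eventually_iff)
    then have *: "\<forall>\<^sub>F u in U. steers r r' a (v + u) (F u)"
      by eventually_elim (auto simp: F_def intro: someI_ex)
    then have "\<forall>\<^sub>F u in U. norm (F u) \<le> 1" by eventually_elim (rule steers_norm)
    from weak_star_limit[OF this] obtain g where "norm g \<le> 1"
      "\<And>x. ((\<lambda>u. blinfun_apply (F u) x) \<longlongrightarrow> blinfun_apply g x) U" by blast
    with steers.move[OF v *] no show False by blast
  qed
qed

lemma eventually_abs_less:
  assumes "((\<lambda>u. blinfun_apply (F u) x) \<longlongrightarrow> blinfun_apply g x) U" "\<bar>blinfun_apply g x\<bar> < e"
  shows "\<forall>\<^sub>F u in U. \<bar>blinfun_apply (F u) x\<bar> < (e::real)"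
  using order_tendstoD(2)[OF tendsto_rabs[OF assms(1)] assms(2)] .

text \<open>
  Here \<open>v1\<close> is the position at which the play ended and \<open>v2\<close> the sum of all later terms, chosen
  in the kernel of the limit functional \<open>h\<close>. The members of \<open>D\<close> are the vectors on which the
  functional has to stay small.
\<close>

definition caught :: "real \<Rightarrow> real \<Rightarrow> 'a \<Rightarrow> 'a set \<Rightarrow> 'a \<Rightarrow> bool" where
  "caught r' e a D v \<longleftrightarrow> (\<exists>h F v1 v2. v = v1 + v2 \<and>
     (\<forall>\<^sub>F u in U. norm (F u) \<le> 1 \<and> r' < blinfun_apply (F u) (a + v1 - u)) \<and>
     (\<forall>x. ((\<lambda>u. blinfun_apply (F u) x) \<longlongrightarrow> blinfun_apply h x) U) \<and>
     (\<forall>z\<in>D. \<bar>blinfun_apply h z\<bar> < e) \<and> blinfun_apply h v2 = 0)"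

definition chased :: "real \<Rightarrow> real \<Rightarrow> real \<Rightarrow> 'a \<Rightarrow> 'a set \<Rightarrow> 'a \<Rightarrow> bool" where
  "chased r r' e a D v \<longleftrightarrow> (\<exists>h. steers r r' a v h \<and> (\<forall>z\<in>D. \<bar>blinfun_apply h z\<bar> < e))"

text \<open>Most \<open>u\<close> lie in the kernel of \<open>h\<close> and are absorbed into
  \<open>v2\<close>.\<close>

lemma caught_step:
  assumes "caught r' e a D v"
  shows "\<forall>\<^sub>F u in U. caught r' e a D (v + u)"
proof -
  obtain h F v1 v2 where c: "v = v1 + v2"
     "\<forall>\<^sub>F u in U. norm (F u) \<le> 1 \<and> r' < blinfun_apply (F u) (a + v1 - u)"
     "\<forall>x. ((\<lambda>u. blinfun_apply (F u) x) \<longlongrightarrow> blinfun_apply h x) U"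
     "\<forall>z\<in>D. \<bar>blinfun_apply h z\<bar> < e" "blinfun_apply h v2 = 0"
    using assms unfolding caught_def by blast
  show ?thesis
    using weakly_null[of h]
  proof eventually_elim
    case (elim u)
    with c show ?case
      unfolding caught_def
      by (intro exI[of _ h] exI[of _ F] exI[of _ v1] exI[of _ "v2 + u"]) (simp add: blinfun.add_right)
  qed
qed

lemma stop_caught:
  assumes "\<forall>\<^sub>F u in U. norm (F u) \<le> 1 \<and> r' < blinfun_apply (F u) (a + v - u)"
    and "\<And>x. ((\<lambda>u. blinfun_apply (F u) x) \<longlongrightarrow> blinfun_apply g x) U"
    and "\<forall>z\<in>D. \<bar>blinfun_apply g z\<bar> < e"
  shows "caught r' e a D v"
  unfolding caught_def using assms
  by (intro exI[of _ g] exI[of _ F] exI[of _ v] exI[of _ 0]) simp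

lemma eventually_abs_less_ball:
  assumes "\<And>x. ((\<lambda>u. blinfun_apply (F u) x) \<longlongrightarrow> blinfun_apply g x) U" "finite D"
    "\<forall>z\<in>D. \<bar>blinfun_apply g z\<bar> < e"
  shows "\<forall>\<^sub>F u in U. \<forall>z\<in>D. \<bar>blinfun_apply (F u) z\<bar> < (e::real)"
  using assms by (auto simp: eventually_ball_finite_distrib intro: eventually_abs_less)

text \<open>If the play has ended at \<open>v\<close>, then \<open>v\<close> is caught and stays so;
  otherwise most \<open>F u\<close> inherit smallness on the finite set \<open>D\<close> from their
  limit.\<close>

lemma chased_step:
  assumes "chased r r' e a D v" and D: "finite D"
  shows "\<forall>\<^sub>F u in U. chased r r' e a D (v + u) \<or> caught r' e a D (v + u)"
proof -
  obtain h where h: "steers r r' a v h" "\<forall>z\<in>D. \<bar>blinfun_apply h z\<bar> < e"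
    using assms(1) by (auto simp: chased_def)
  from h(1) show ?thesis
  proof cases
    case (stop F)
    from caught_step[OF stop_caught[OF stop(2,4) h(2)]] show ?thesis by eventually_elim simp
  next
    case (move F)
    from move(2) eventually_abs_less_ball[OF move(4) D h(2)] show ?thesis
      by eventually_elim (auto simp: chased_def)
  qed
qed

text \<open>The play can be brought to an end because \<open>steers\<close> is generated
  inductively. \<open>Q\<close> is an invariant of most moves and carries the state of the other
  plays along.\<close>

lemma chased_until_caught:
  assumes D: "finite D" and "chased r r' e a D v" and "Q v"
    and Q: "\<And>v. Q v \<Longrightarrow> \<forall>\<^sub>F u in U. Q (v + u)"
  obtains w where "Q w" "tame r w" "caught r' e a D w"
proof -
  obtain h where "steers r r' a v h" "\<forall>z\<in>D. \<bar>blinfun_apply h z\<bar> < e"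
    using assms(2) by (auto simp: chased_def)
  then have "\<exists>w. Q w \<and> tame r w \<and> caught r' e a D w"
    using \<open>Q v\<close>
  proof (induction rule: steers.induct)
    case (stop v F g)
    then have "caught r' e a D v" by (intro stop_caught)
    with stop show ?case by blast
  next
    case (move v F g)
    then have "\<forall>\<^sub>F u in U. \<forall>z\<in>D. \<bar>blinfun_apply (F u) z\<bar> < e"
      using D by (intro eventually_abs_less_ball)
    with move.IH Q[OF \<open>Q v\<close>] have "\<forall>\<^sub>F u in U. \<exists>w. Q w \<and> tame r w \<and> caught r' e a D w"
      by eventually_elim blast
    with nontrivial show ?case by simp
  qed
  then show thesis using that by blast
qed

text \<open>One sum serves all plays, as finitely many demands met by most \<open>u\<close> combine.
  The indices are caught one after the other, while those already caught remain so.\<close>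

lemma all_caught:
  fixes a :: "'i \<Rightarrow> 'a" and N :: "('a \<Rightarrow>\<^sub>L real) set"
  assumes fin: "finite T" "\<And>i. i \<in> T \<Longrightarrow> finite (D i)" "finite N" and r: "1 \<le> r"
    and start: "\<And>i. i \<in> T \<Longrightarrow> chased r r' e (a i) (D i) 0"
  obtains v where "tame r v" "\<forall>f\<in>N. blinfun_apply f v = 0" "\<forall>i\<in>T. caught r' e (a i) (D i) v"
proof -
  define Q where "Q T' v \<longleftrightarrow> (\<forall>f\<in>N. blinfun_apply f v = 0) \<and>
     (\<forall>i\<in>T. chased r r' e (a i) (D i) v \<or> caught r' e (a i) (D i) v) \<and>
     (\<forall>i\<in>T'. caught r' e (a i) (D i) v)" for T' v
  have Q_step: "\<forall>\<^sub>F u in U. Q T' (v + u)" if Q: "Q T' v" and T': "T' \<subseteq> T" for T' v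
  proof -
    have "\<forall>\<^sub>F u in U. \<forall>f\<in>N. blinfun_apply f u = 0"
      using fin(3) weakly_null by (simp add: eventually_ball_finite_distrib)
    moreover have "\<forall>\<^sub>F u in U. \<forall>i\<in>T. chased r r' e (a i) (D i) (v + u) \<or> caught r' e (a i) (D i) (v + u)"
    proof (subst eventually_ball_finite_distrib[OF fin(1)], rule ballI)
      fix i assume i: "i \<in> T"
      with Q consider "chased r r' e (a i) (D i) v" | "caught r' e (a i) (D i) v" by (auto simp: Q_def)
      then show "\<forall>\<^sub>F u in U. chased r r' e (a i) (D i) (v + u) \<or> caught r' e (a i) (D i) (v + u)"
      proof cases
        case 1
        then show ?thesis using fin(2)[OF i] by (rule chased_step)
      next
        case 2
        from caught_step[OF this] show ?thesis by eventually_elim simp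
      qed
    qed
    moreover have "\<forall>\<^sub>F u in U. \<forall>i\<in>T'. caught r' e (a i) (D i) (v + u)"
      using Q finite_subset[OF T' fin(1)]
      by (auto simp: eventually_ball_finite_distrib Q_def intro: caught_step)
    ultimately show ?thesis
      by eventually_elim (use Q in \<open>auto simp: Q_def blinfun.add_right\<close>)
  qed
  have "\<exists>v. tame r v \<and> Q T' v" if "finite T'" "T' \<subseteq> T" for T'
    using that
  proof (induction T')
    case empty
    show ?case using start tame_zero[OF r] by (intro exI[of _ 0]) (auto simp: Q_def)
  next
    case (insert i T')
    then obtain v where v: "tame r v" "Q T' v" by auto
    have i: "i \<in> T" and T': "T' \<subseteq> T" using insert.prems by auto
    show ?case
    proof (cases "caught r' e (a i) (D i) v")
      case True
      with v show ?thesis by (intro exI[of _ v]) (auto simp: Q_def)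
    next
      case False
      with v(2) i have "chased r r' e (a i) (D i) v" by (auto simp: Q_def)
      from chased_until_caught[OF fin(2)[OF i] this, of "Q T'", OF v(2) Q_step[OF _ T']]
      obtain w where "Q T' w" "tame r w" "caught r' e (a i) (D i) w" by blast
      then show ?thesis by (intro exI[of _ w]) (auto simp: Q_def)
    qed
  qed
  from this[OF fin(1) subset_refl] that show thesis by (auto simp: Q_def)
qed

text \<open>The witnesses \<open>F u\<close> belong to the position \<open>v1\<close>; since
  \<open>h\<close> vanishes at \<open>v2\<close>, the later terms cost less than
  \<open>e\<close>.\<close>

lemma caught_functional:
  assumes "caught r' e a D v" and D: "finite D" and e: "e > 0"
  shows "\<forall>\<^sub>F u in U. \<exists>f :: 'a \<Rightarrow>\<^sub>L real. norm f \<le> 1 \<and> (\<forall>z\<in>D. \<bar>blinfun_apply f z\<bar> < e) \<and> r' - e < blinfun_apply f (a + v - u)"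
proof -
  obtain h F v1 v2 where c: "v = v1 + v2"
     "\<forall>\<^sub>F u in U. norm (F u) \<le> 1 \<and> r' < blinfun_apply (F u) (a + v1 - u)"
     "\<And>x. ((\<lambda>u. blinfun_apply (F u) x) \<longlongrightarrow> blinfun_apply h x) U"
     "\<forall>z\<in>D. \<bar>blinfun_apply h z\<bar> < e" "blinfun_apply h v2 = 0"
    using assms(1) unfolding caught_def by blast
  have "\<forall>\<^sub>F u in U. \<forall>z\<in>insert v2 D. \<bar>blinfun_apply (F u) z\<bar> < e"
    using c e D by (intro eventually_abs_less_ball[where g = h]) auto
  with c(2) show ?thesis
  proof eventually_elim
    case (elim u)
    have "blinfun_apply (F u) (a + v - u) = blinfun_apply (F u) (a + v1 - u) + blinfun_apply (F u) v2"
      by (simp add: c(1) blinfun.add_right blinfun.diff_right)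
    with elim show ?case by (intro exI[of _ "F u"]) auto
  qed
qed

section \<open>The two antipodal sequences\<close>

text \<open>With c the small value of \<open>\<phi> (a n)\<close> at \<open>W a n\<close>, this
  functional is c - 1 at \<open>Z n\<close>, c + 1 at all later vectors and small at the earlier
  ones.\<close>

lemma sequence_if_tame_forever:
  assumes r: "\<And>k. 1 \<le> r k"
    and no: "\<And>k. \<forall>\<^sub>F a in U. \<not> (\<exists>g. steers (r (Suc k)) (r k) a 0 g)"
  obtains Z :: "nat \<Rightarrow> 'a" where "antipodal_sequence (r 0) 2 Z"
proof -
  define \<phi> where "\<phi> = (norming :: 'a \<Rightarrow> _)"
  have "\<forall>\<^sub>F u in U. norm (\<phi> u) \<le> 1" by (simp add: \<phi>_def norming)
  then obtain g where lim: "\<And>x. ((\<lambda>u. blinfun_apply (\<phi> u) x) \<longlongrightarrow> blinfun_apply g x) U"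
    by (rule weak_star_limit) blast
  define W where "W a n = (\<Sum>i<n. a i)" for a :: "nat \<Rightarrow> 'a" and n
  \<comment> \<open>The kernel of \<open>g\<close> makes later \<open>\<phi> u\<close> small on what
    is built so far; the other kernels hide \<open>u\<close> from earlier functionals; the last two
    clauses keep all plays unsuccessful. Any constant up to 1/2 could replace 1/4.\<close>
  define P where "P a n u \<longleftrightarrow> norm (W a n - u) \<le> r 0 \<and> norm u = 1 \<and>
     (\<forall>z\<in>insert (W a n) ((\<lambda>k. W a k - a k) ` {..<n}). \<bar>blinfun_apply (\<phi> u) z\<bar> < 1/4) \<and>
     (\<forall>f\<in>insert g ((\<lambda>m. \<phi> (a m)) ` {..<n}). blinfun_apply f u = 0) \<and>
     \<not> (\<exists>h. steers (r (Suc n)) (r n) u 0 h) \<and>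
     (\<forall>j\<in>{..<n}. \<not> (\<exists>h. steers (r (Suc j)) (r j) (a j) (sum a {Suc j..<n} + u) h))"
    for a :: "nat \<Rightarrow> 'a" and n u
  have P_cong: "P a n u = P b n u" if eq: "\<And>k. k < n \<Longrightarrow> a k = b k" for a b n u
  proof -
    have "W a k = W b k" if "k \<le> n" for k
      unfolding W_def using that by (intro sum.cong refl eq) auto
    moreover have "sum a {Suc j..<n} = sum b {Suc j..<n}" for j
      by (intro sum.cong refl eq) auto
    moreover have "(\<lambda>m. \<phi> (a m)) ` {..<n} = (\<lambda>m. \<phi> (b m)) ` {..<n}"
      by (intro image_cong refl) (simp add: eq)
    moreover have "(\<lambda>k. W a k - a k) ` {..<n} = (\<lambda>k. W b k - b k) ` {..<n}"
      by (intro image_cong refl) (simp add: eq calculation(1))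
    ultimately show ?thesis unfolding P_def by (simp add: eq)
  qed
  have P_ex: "\<exists>u. P a n u" if prev: "\<And>k. k < n \<Longrightarrow> P a k (a k)" for a n
  proof -
    \<comment> \<open>For \<open>n = Suc j\<close> the position is the empty sum; otherwise stage
      \<open>n - 1\<close> has excluded steering.\<close>
    have free: "\<not> (\<exists>h. steers (r (Suc j)) (r j) (a j) (sum a {Suc j..<n}) h)" if j: "j < n" for j
    proof (cases "n = Suc j")
      case True
      with prev[OF j] show ?thesis by (simp add: P_def)
    next
      case False
      then obtain m where m: "n = Suc m" "j < m" using j by (cases n) auto
      with prev[of m] show ?thesis by (simp add: P_def)
    qed
    \<comment> \<open>Downward from the empty sum at \<open>j = n\<close>: adding \<open>a j\<close>
      relaxes the radius from \<open>r (Suc j)\<close> to \<open>r j\<close>.\<close>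
    have tame_sum: "tame (r j) (sum a {j..<n})" if "j \<le> n" for j
      using that
    proof (induction rule: inc_induct)
      case base
      show ?case using tame_zero[OF r] by simp
    next
      case (step j)
      from not_steers(1)[OF step.IH free[OF step.hyps(2)]] step.hyps show ?case
        by (simp add: sum.atLeast_Suc_lessThan)
    qed
    have "\<forall>\<^sub>F u in U. norm (W a n - u) \<le> r 0"
      using tame_sum[of 0] by (simp add: tame_def W_def atLeast0LessThan)
    moreover note sphere
    moreover have "\<forall>\<^sub>F u in U. \<forall>z\<in>insert (W a n) ((\<lambda>k. W a k - a k) ` {..<n}). \<bar>blinfun_apply (\<phi> u) z\<bar> < 1/4"
    proof (rule eventually_abs_less_ball[OF lim])
      have ga: "blinfun_apply g (a k) = 0" if "k < n" for k using prev[OF that] by (simp add: P_def)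
      have "blinfun_apply g (W a k) = 0" if "k \<le> n" for k
        using that by (simp add: W_def blinfun.sum_right ga)
      with ga show "\<forall>z\<in>insert (W a n) ((\<lambda>k. W a k - a k) ` {..<n}). \<bar>blinfun_apply g z\<bar> < 1/4"
        by (auto simp: blinfun.diff_right)
    qed simp
    moreover have "\<forall>\<^sub>F u in U. \<forall>f\<in>insert g ((\<lambda>m. \<phi> (a m)) ` {..<n}). blinfun_apply f u = 0"
      by (subst eventually_ball_finite_distrib) (auto intro: weakly_null)
    moreover note no[of n]
    moreover have "\<forall>\<^sub>F u in U. \<forall>j\<in>{..<n}. \<not> (\<exists>h. steers (r (Suc j)) (r j) (a j) (sum a {Suc j..<n} + u) h)"
      by (subst eventually_ball_finite_distrib, simp)
         (blast intro: not_steers(2)[OF tame_sum free] Suc_leI)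
    ultimately have "\<forall>\<^sub>F u in U. P a n u"
      unfolding P_def by eventually_elim blast
    with nontrivial show ?thesis using eventually_happens by blast
  qed
  have "\<exists>a. \<forall>n. P a n (a n)"
    by (rule dependent_wellorder_choice) (erule P_cong, erule P_ex)
  then obtain a where a: "\<And>n. P a n (a n)" by blast
  define Z where "Z n = W a n - a n" for n
  have norm_a: "norm (a n) = 1" for n using a[of n] by (simp add: P_def)
  have later: "blinfun_apply (\<phi> (a n)) (a m) = 0" if "n < m" for n m
    using a[of m] that by (simp add: P_def)
  have self: "blinfun_apply (\<phi> (a n)) (a n) = 1" for n
    by (simp add: \<phi>_def norming norm_a)
  have W_later: "blinfun_apply (\<phi> (a n)) (W a m) = blinfun_apply (\<phi> (a n)) (W a n) + 1" if "Suc n \<le> m" for n m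
    using that
  proof (induction rule: dec_induct)
    case base
    show ?case by (simp add: W_def blinfun.add_right self)
  next
    case (step m)
    then show ?case using later[of n m] by (simp add: W_def blinfun.add_right)
  qed
  have small: "\<bar>blinfun_apply (\<phi> (a n)) (W a n)\<bar> < 1/4" for n
    using a[of n] by (simp add: P_def)
  have small_Z: "\<bar>blinfun_apply (\<phi> (a n)) (Z k)\<bar> < 1/4" if "k < n" for n k
    using a[of n] that by (simp add: P_def Z_def)
  have Z_later: "blinfun_apply (\<phi> (a n)) (Z m) = blinfun_apply (\<phi> (a n)) (W a n) + 1" if "n < m" for n m
    using W_later[of n m] later[OF that] that by (simp add: Z_def blinfun.diff_right)
  have Z_self: "blinfun_apply (\<phi> (a n)) (Z n) = blinfun_apply (\<phi> (a n)) (W a n) - 1" for n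
    by (simp add: Z_def blinfun.diff_right self)
  show thesis
  proof (rule that, unfold antipodal_sequence_def, intro conjI allI impI)
    show "norm (Z n) \<le> r 0" for n using a[of n] by (simp add: P_def Z_def)
    fix n m :: nat assume nm: "n < m"
    have "blinfun_apply (\<phi> (a n)) (Z n) \<le> blinfun_apply (\<phi> (a n)) (Z k) \<and>
        blinfun_apply (\<phi> (a n)) (Z k) \<le> blinfun_apply (\<phi> (a n)) (Z m)" for k
      using small[of n] small_Z[of k n] Z_later[of n k] Z_later[OF nm] Z_self[of n]
      by (cases k n rule: linorder_cases) auto
    moreover have "2 \<le> blinfun_apply (\<phi> (a n)) (Z m) - blinfun_apply (\<phi> (a n)) (Z n)"
      using Z_later[OF nm] Z_self[of n] by simp
    ultimately show "\<exists>f :: 'a \<Rightarrow>\<^sub>L real. norm f \<le> 1 \<and> 2 \<le> blinfun_apply f (Z m) - blinfun_apply f (Z n) \<and>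
       (\<forall>k. blinfun_apply f (Z n) \<le> blinfun_apply f (Z k) \<and> blinfun_apply f (Z k) \<le> blinfun_apply f (Z m))"
      using norming(1)[of "a n"] unfolding \<phi>_def by blast
  qed
qed

text \<open>Of the gap \<open>3 * e\<close>, one \<open>e\<close> is lost in
  \<open>caught_functional\<close>, one on the first component of the earlier vector, and one
  remains above the norm bound \<open>r\<close>.\<close>

lemma sequence_if_always_caught:
  assumes r: "1 \<le> r" and e: "e > 0" and r': "r' = r + 3 * e"
    and all: "\<forall>\<^sub>F a in U. \<exists>g. steers r r' a 0 g"
  obtains y :: "nat \<Rightarrow> 'a" where "antipodal_sequence r (r + e) y"
proof -
  define \<gamma> where "\<gamma> a = (SOME g. steers r r' a 0 g)" for a
  have steers: "\<forall>\<^sub>F a in U. steers r r' a 0 (\<gamma> a)"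
    using all by eventually_elim (auto simp: \<gamma>_def intro: someI_ex)
  then have "\<forall>\<^sub>F a in U. norm (\<gamma> a) \<le> 1" by eventually_elim (rule steers_norm)
  then obtain g where lim: "\<And>x. ((\<lambda>a. blinfun_apply (\<gamma> a) x) \<longlongrightarrow> blinfun_apply g x) U"
    by (rule weak_star_limit) blast
  \<comment> \<open>Stage \<open>n\<close> of the construction is a triple \<open>(v, a, N)\<close>, where \<open>N\<close> holds the functionals separating
    \<open>v - a\<close> from its predecessors; all later vectors are chosen in their kernels.\<close>
  define y where "y s n = fst (s n) - fst (snd (s n))"
    for s :: "nat \<Rightarrow> 'a \<times> 'a \<times> ('a \<Rightarrow>\<^sub>L real) set" and n
  \<comment> \<open>Kernel of \<open>g\<close>: later \<open>\<gamma> a\<close> can be small on the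
    vector. Kernels of the earlier \<open>\<gamma>\<close>: those plays can be restarted from 0 with
    the vector added to their \<open>D\<close>.\<close>
  define S where "S s m = insert g ((\<lambda>n. \<gamma> (fst (snd (s n)))) ` {..<m} \<union> (\<Union>n<m. snd (snd (s n))))"
    for s :: "nat \<Rightarrow> 'a \<times> 'a \<times> ('a \<Rightarrow>\<^sub>L real) set" and m
  define Q where "Q s m v a N \<longleftrightarrow> norm (v - a) \<le> r \<and> steers r r' a 0 (\<gamma> a) \<and>
      (\<forall>z\<in>insert v (y s ` {..<m}). \<bar>blinfun_apply (\<gamma> a) z\<bar> < e) \<and>
      (\<forall>f\<in>S s m. blinfun_apply f (v - a) = 0) \<and> finite N \<and>
      (\<forall>n\<in>{..<m}. \<exists>f\<in>N. norm f \<le> 1 \<and> (\<forall>z\<in>y s ` ({..<m} - {n}). \<bar>blinfun_apply f z\<bar> < e) \<and>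
          r + e < blinfun_apply f (v - a) - blinfun_apply f (y s n))"
    for s m v a N
  define P where "P s m t \<longleftrightarrow> Q s m (fst t) (fst (snd t)) (snd (snd t))" for s m t
  have P_cong: "P s m t = P s' m t" if eq: "\<And>k. k < m \<Longrightarrow> s k = s' k" for s s' m t
  proof -
    have y_eq: "y s n = y s' n" if "n < m" for n by (simp add: y_def eq[OF that])
    then have "y s ` A = y s' ` A" if "A \<subseteq> {..<m}" for A
      using that by (intro image_cong refl) auto
    moreover have "S s m = S s' m" unfolding S_def by (simp add: eq)
    ultimately show ?thesis unfolding P_def Q_def by (simp add: y_eq)
  qed
  have P_ex: "\<exists>t. P s m t" if prev: "\<And>k. k < m \<Longrightarrow> P s k (s k)" for s m
  proof -
    define V where "V n = fst (s n)" for n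
    define A where "A n = fst (snd (s n))" for n
    define D where "D n = insert (V n) (y s ` ({..<m} - {n}))" for n
    have yVA: "y s n = V n - A n" for n by (simp add: y_def V_def A_def)
    have prevQ: "Q s k (V k) (A k) (snd (snd (s k)))" if "k < m" for k
      using prev[OF that] by (simp add: P_def V_def A_def)
    have finS: "finite (S s m)"
      using prevQ by (auto simp: S_def Q_def)
    have finD: "finite (D n)" for n by (simp add: D_def)
    \<comment> \<open>Every stage replays all earlier plays from 0. \<open>\<gamma> (A n)\<close> is
      small on \<open>V n\<close> and the vectors before stage \<open>n\<close> by the choice of
      \<open>A n\<close>, and zero on those after it.\<close>
    have "chased r r' e (A n) (D n) 0" if n: "n < m" for n
      unfolding chased_def
    proof (intro exI conjI ballI)
      show "steers r r' (A n) 0 (\<gamma> (A n))" using prevQ[OF n] by (simp add: Q_def)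
      fix z assume "z \<in> D n"
      then consider "z = V n" | k where "k < n" "z = y s k" | k where "n < k" "k < m" "z = y s k"
        by (auto simp: D_def) (metis linorder_neqE_nat)
      then show "\<bar>blinfun_apply (\<gamma> (A n)) z\<bar> < e"
      proof cases
        case 3
        then have "blinfun_apply (\<gamma> (A n)) z = 0"
          using prevQ[OF 3(2)] by (auto simp: Q_def S_def yVA A_def)
        with e show ?thesis by simp
      qed (use prevQ[OF n] in \<open>auto simp: Q_def\<close>)
    qed
    then obtain v where v: "tame r v" "\<forall>f\<in>S s m. blinfun_apply f v = 0"
      "\<forall>n\<in>{..<m}. caught r' e (A n) (D n) v"
      using all_caught[of "{..<m}" D "S s m" r r' e A] finS finD r by auto
    define good where "good n a f \<longleftrightarrow> norm f \<le> 1 \<and> (\<forall>z\<in>D n. \<bar>blinfun_apply f z\<bar> < e) \<and>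
        r' - e < blinfun_apply f (A n + v - a)" for n a and f :: "'a \<Rightarrow>\<^sub>L real"
    have "\<forall>\<^sub>F a in U. \<forall>n\<in>{..<m}. \<exists>f. good n a f"
      unfolding good_def
      by (subst eventually_ball_finite_distrib, simp)
         (intro ballI caught_functional[OF v(3)[rule_format] finD e])
    moreover have "\<forall>\<^sub>F a in U. \<forall>f\<in>S s m. blinfun_apply f a = 0"
      using finS weakly_null by (simp add: eventually_ball_finite_distrib)
    moreover have "\<forall>\<^sub>F a in U. \<forall>z\<in>insert v (y s ` {..<m}). \<bar>blinfun_apply (\<gamma> a) z\<bar> < e"
    proof (rule eventually_abs_less_ball[OF lim])
      have "blinfun_apply g v = 0" using v(2) by (simp add: S_def)
      moreover have "blinfun_apply g (y s k) = 0" if "k < m" for k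
        using prevQ[OF that] by (simp add: Q_def S_def yVA)
      ultimately show "\<forall>z\<in>insert v (y s ` {..<m}). \<bar>blinfun_apply g z\<bar> < e" using e by auto
    qed simp
    moreover note steers v(1)[unfolded tame_def]
    ultimately have "\<forall>\<^sub>F a in U. \<exists>N. Q s m v a N"
    proof eventually_elim
      case (elim a)
      from elim(1) obtain f where f: "\<And>n. n < m \<Longrightarrow> good n a (f n)"
        unfolding Ball_def lessThan_iff by metis
      \<comment> \<open>The difference is the value at \<open>A n + v - a\<close> minus that at
        \<open>V n\<close>, hence above \<open>r' - 2 * e\<close>.\<close>
      have "r + e < blinfun_apply (f n) (v - a) - blinfun_apply (f n) (y s n)" if "n < m" for n
      proof -
        have "\<bar>blinfun_apply (f n) (V n)\<bar> < e" "r' - e < blinfun_apply (f n) (A n + v - a)"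
          using f[OF that] by (auto simp: good_def D_def)
        then show ?thesis by (simp add: r' yVA blinfun.diff_right blinfun.add_right)
      qed
      moreover have "norm (f n) \<le> 1" "\<forall>z\<in>y s ` ({..<m} - {n}). \<bar>blinfun_apply (f n) z\<bar> < e" if "n < m" for n
        using f[OF that] by (auto simp: good_def D_def)
      ultimately have "\<forall>n\<in>{..<m}. \<exists>h\<in>f ` {..<m}. norm h \<le> 1 \<and>
          (\<forall>z\<in>y s ` ({..<m} - {n}). \<bar>blinfun_apply h z\<bar> < e) \<and>
          r + e < blinfun_apply h (v - a) - blinfun_apply h (y s n)"
        by (intro ballI) (rule bexI[of _ "f _"], auto)
      moreover have "\<forall>h\<in>S s m. blinfun_apply h (v - a) = 0"
        using elim(2) v(2) by (simp add: blinfun.diff_right)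
      ultimately show ?case
        unfolding Q_def using elim by (intro exI[of _ "f ` {..<m}"]) blast
    qed
    then obtain a N where "Q s m v a N" using nontrivial eventually_happens by blast
    then show ?thesis by (intro exI[of _ "(v, a, N)"]) (simp add: P_def)
  qed
  have "\<exists>s. \<forall>m. P s m (s m)"
    by (rule dependent_wellorder_choice) (erule P_cong, erule P_ex)
  then obtain s where "\<And>m. P s m (s m)" by blast
  then have s: "Q s m (fst (s m)) (fst (snd (s m))) (snd (snd (s m)))" for m by (simp add: P_def)
  show thesis
  proof (rule that, unfold antipodal_sequence_def, intro conjI allI impI)
    show norm_y: "norm (y s n) \<le> r" for n using s[of n] by (simp add: Q_def y_def)
    fix n m :: nat assume nm: "n < m"
    then obtain f where f: "f \<in> snd (snd (s m))" "norm f \<le> 1"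
        "\<And>k. k < m \<Longrightarrow> k \<noteq> n \<Longrightarrow> \<bar>blinfun_apply f (y s k)\<bar> < e"
        "r + e < blinfun_apply f (y s m) - blinfun_apply f (y s n)"
      using s[of m] unfolding Q_def y_def[of s m] by (fastforce simp: y_def[of s m])
    have later: "blinfun_apply f (y s k) = 0" if "m < k" for k
      using s[of k] that f(1) by (auto simp: Q_def S_def y_def)
    have "\<bar>blinfun_apply f (y s k)\<bar> \<le> r" for k
      using norm_blinfun[of f "y s k"] mult_right_mono[OF f(2), of "norm (y s k)"] norm_y[of k] by simp
    \<comment> \<open>Both values are at most \<open>r\<close> in modulus, so a difference above
      \<open>r + e\<close> pushes them beyond \<open>e\<close> and \<open>- e\<close>, outside the
      range of all others.\<close>
    from this[of n] this[of m] f(4) have *: "e < blinfun_apply f (y s m)" "blinfun_apply f (y s n) < - e"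
      by linarith+
    have "blinfun_apply f (y s n) \<le> blinfun_apply f (y s k) \<and> blinfun_apply f (y s k) \<le> blinfun_apply f (y s m)" for k
    proof (cases "k = n \<or> k = m")
      case True
      with * e show ?thesis by auto
    next
      case False
      then have "\<bar>blinfun_apply f (y s k)\<bar> < e"
        using f(3)[of k] later[of k] e by (cases k m rule: linorder_cases) auto
      with * show ?thesis by linarith
    qed
    with f(2,4) show "\<exists>f :: 'a \<Rightarrow>\<^sub>L real. norm f \<le> 1 \<and> r + e \<le> blinfun_apply f (y s m) - blinfun_apply f (y s n) \<and>
       (\<forall>k. blinfun_apply f (y s n) \<le> blinfun_apply f (y s k) \<and> blinfun_apply f (y s k) \<le> blinfun_apply f (y s m))"
      by (intro exI[of _ f]) auto
  qed
qed

end

section \<open>Choice of the radii and the dichotomy\<close>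

theorem theorem1p10:
  assumes "infinite_dimensional TYPE('a::banach)"
  shows "K_a TYPE('a) > 1"
proof -
  obtain U :: "'a filter" where "weakly_null_ultrafilter U"
    using weakly_null_ultrafilter_exists[OF assms] .
  then interpret weakly_null_ultrafilter U .
  \<comment> \<open>Strictly decreasing, so that each step leaves a positive gap; at least 1, so
    that 0 is tame; and \<open>r 0\<close> is 3/2, below the separation 2.\<close>
  define r :: "nat \<Rightarrow> real" where "r k = 1 + 1 / (real k + 2)" for k
  have r1: "1 \<le> r k" for k by (simp add: r_def)
  show ?thesis
  proof (cases "\<exists>k. \<forall>\<^sub>F a in U. \<exists>g. steers (r (Suc k)) (r k) a 0 g")
    case True
    then obtain k where k: "\<forall>\<^sub>F a in U. \<exists>g. steers (r (Suc k)) (r k) a 0 g" ..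
    define e where "e = (r k - r (Suc k)) / 3"
    have e: "e > 0" by (simp add: e_def r_def frac_less2)
    have rk: "r k = r (Suc k) + 3 * e" by (simp add: e_def field_simps)
    obtain y :: "nat \<Rightarrow> 'a" where "antipodal_sequence (r (Suc k)) (r (Suc k) + e) y"
      using sequence_if_always_caught[OF r1 e rk k] .
    moreover have "0 < r (Suc k)" "r (Suc k) < r (Suc k) + e" using r1[of "Suc k"] e by auto
    ultimately show ?thesis by (intro K_a_gt_one_if_antipodal_sequence)
  next
    case False
    then have no: "\<forall>\<^sub>F a in U. \<not> (\<exists>g. steers (r (Suc k)) (r k) a 0 g)" for k
      by (simp add: not_eventually_iff)
    obtain Z :: "nat \<Rightarrow> 'a" where "antipodal_sequence (r 0) 2 Z"
      using sequence_if_tame_forever[of r, OF r1 no] .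
    moreover have "0 < r 0" "r 0 < 2" by (simp_all add: r_def)
    ultimately show ?thesis by (intro K_a_gt_one_if_antipodal_sequence)
  qed
qed

end
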